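(* Let $D$, $D'$ be ultrafilters and let $\lambda,\mu$ be infinite cardinals. The following are equivalent: (a) $D\times D'$ is $(\lambda,\mu)$-regular; (b) there is a cardinal $\nu$ such that $D$ is $(\nu,\mu)$-regular and $D'$ is $(\lambda,\nu')$-regular for all $\nu'<\nu$. Thus, in particular, $D\times D'$ is $(\lambda,\lambda)$-regular if and only if either $D$ is $(\lambda,\lambda)$-regular or $D'$ is $(\lambda,\lambda)$-regular.
   Context: We work in ZFC. For infinite cardinals $\mu,\lambda$, an ultrafilter $D$ over a set $I$ is $(\mu,\lambda)$-regular if there is an indexed family $(X_\alpha)_{\alpha<\lambda}$ of members of $D$ such that $\bigcap_{\alpha\in A}X_\alpha=\emptyset$ whenever $A\subseteq\lambda$ and $|A|=\mu$. Regularity is considered for infinite cardinals, so $\nu$ and $\nu'$ in (b) are infinite cardinals. If $D$ is an ultrafilter over $I$ and $D'$ is an ultrafilter over $I'$, then $D\times D'$ is the ultrafilter over $I\times I'$ defined by: $X\in D\times D'$ if and only if $\{i\in I\mid\{i'\in I'\mid(i,i')\in X\}\in D'\}\in D$. *)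

theory Defs
  imports Main
begin

unbundle cardinal_syntax

(* An ultrafilter over a set I is a filter on a type 'i (the set I is the whole type); its members
   are the sets X with "eventually (\<lambda>i. i \<in> X)". The condition D \<noteq> bot is needed because
   the type 'i filter contains the improper filter. *)
definition ultrafilter :: "'i filter \<Rightarrow> bool" where
  "ultrafilter D \<longleftrightarrow>
     D \<noteq> bot \<and> (\<forall>P. eventually P D \<or> eventually (\<lambda>i. \<not> P i) D)"

(* This is the iterated (non-commutative) product, not the library's prod_filter, which is
   generated by the rectangles and is in general strictly coarser. *)
definition ultrafilter_prod :: "'i filter \<Rightarrow> 'j filter \<Rightarrow> ('i \<times> 'j) filter"
    (infixr \<open>\<times>\<^sub>U\<close> 80) where
  "D \<times>\<^sub>U D' = Abs_filter (\<lambda>P. eventually (\<lambda>i. eventually (\<lambda>i'. P (i, i')) D') D)"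

lemma eventually_ultrafilter_prod:
  "eventually P (D \<times>\<^sub>U D') \<longleftrightarrow> eventually (\<lambda>i. eventually (\<lambda>i'. P (i, i')) D') D"
proof -
  have "is_filter (\<lambda>P. eventually (\<lambda>i. eventually (\<lambda>i'. P (i, i')) D') D)"
    by (rule is_filter.intro) (auto simp: eventually_conj_iff elim!: eventually_mono)
  then show ?thesis
    by (simp add: ultrafilter_prod_def eventually_Abs_filter)
qed

lemma ultrafilter_ultrafilter_prod:
  assumes D: "ultrafilter D" and D': "ultrafilter D'"
  shows "ultrafilter (D \<times>\<^sub>U D')"
proof -
  have neg: "eventually (\<lambda>x. \<not> P x) D' \<longleftrightarrow> \<not> eventually P D'" for P
    using D' eventually_conj_iff[of P "\<lambda>x. \<not> P x" D']
    by (auto simp: ultrafilter_def trivial_limit_def)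
  have "D \<times>\<^sub>U D' \<noteq> bot"
    using D D' by (simp add: ultrafilter_def trivial_limit_def eventually_ultrafilter_prod)
  moreover have "eventually P (D \<times>\<^sub>U D') \<or> eventually (\<lambda>x. \<not> P x) (D \<times>\<^sub>U D')" for P
    using D by (simp add: ultrafilter_def eventually_ultrafilter_prod neg)
  ultimately show ?thesis
    by (simp add: ultrafilter_def)
qed

(* (\<mu>,\<kappa>)-regularity, meant for infinite cardinals. A cardinal is a Card_order on an arbitrary
   type, so the ordinals \<alpha> < \<kappa> are the elements of Field \<kappa>. *)
definition regular :: "'a rel \<Rightarrow> 'b rel \<Rightarrow> 'i filter \<Rightarrow> bool" where
  "regular \<mu> \<kappa> D \<longleftrightarrow>
     (\<exists>X :: 'b \<Rightarrow> 'i set.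
        (\<forall>\<alpha>\<in>Field \<kappa>. eventually (\<lambda>i. i \<in> X \<alpha>) D) \<and>
        (\<forall>A. A \<subseteq> Field \<kappa> \<and> |A| =o \<mu> \<longrightarrow> (\<Inter>\<alpha>\<in>A. X \<alpha>) = {}))"

end

theory Submission
  imports Defs
begin

text \<open>
  A family \<open>X\<close> witnesses \<open>(\<kappa>, \<mu>)\<close>-regularity iff every point lies in fewer than \<open>\<kappa>\<close> of the sets
  \<open>X \<alpha>\<close>. Given a witness \<open>Z\<close> for the product, \<open>Y \<alpha>\<close>, the set of \<open>i\<close> whose section of \<open>Z \<alpha>\<close> is
  large, is large, and \<open>\<nu>\<close> is the least infinite cardinal above all \<open>|S i|\<close> with
  \<open>S i = {\<alpha>. i \<in> Y \<alpha>}\<close>: any \<open>\<nu>' < \<nu>\<close> is at most some \<open>|S i|\<close>, and the sections of \<open>Z\<close> at this \<open>i\<close>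
  form a witness on \<open>D'\<close> indexed by \<open>S i\<close>. Conversely, given a witness \<open>Y\<close> for \<open>D\<close>, each \<open>S i\<close> has
  fewer than \<open>\<nu>\<close> elements, so one glues together, over \<open>i\<close>, witnesses on \<open>D'\<close> indexed by \<open>S i\<close>.
\<close>

lemma Card_order_ordLeq_if_not_ordLess:
  assumes "Card_order r" and "Card_order s" and "\<not> r <o s"
  shows "s \<le>o r"
  using assms(3) not_ordLess_iff_ordLeq[OF assms(2,1)[THEN card_order_on_well_order_on]] by blast

text \<open>If a point lies in at least \<open>\<kappa>\<close> of the sets, then exactly
  \<open>\<kappa>\<close> of them can be selected, and these share that point. Conversely, a common
  point of \<open>\<kappa>\<close> of the sets lies in at least \<open>\<kappa>\<close> of
  them.\<close>

lemma regular_iff: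
  fixes \<kappa> :: "'a rel" and \<mu> :: "'b rel" and D :: "'i filter"
  assumes \<kappa>: "Card_order \<kappa>"
  shows "regular \<kappa> \<mu> D \<longleftrightarrow>
    (\<exists>X. (\<forall>\<alpha>\<in>Field \<mu>. eventually (\<lambda>i. i \<in> X \<alpha>) D) \<and>
         (\<forall>i. |{\<alpha> \<in> Field \<mu>. i \<in> X \<alpha>}| <o \<kappa>))"
proof -
  have "(\<forall>A. A \<subseteq> Field \<mu> \<and> |A| =o \<kappa> \<longrightarrow> (\<Inter>\<alpha>\<in>A. X \<alpha>) = {}) \<longleftrightarrow>
        (\<forall>i. |{\<alpha> \<in> Field \<mu>. i \<in> X \<alpha>}| <o \<kappa>)" for X :: "'b \<Rightarrow> 'i set"
  proof (intro iffI allI impI)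
    fix i
    assume L: "\<forall>A. A \<subseteq> Field \<mu> \<and> |A| =o \<kappa> \<longrightarrow> (\<Inter>\<alpha>\<in>A. X \<alpha>) = {}"
    let ?S = "{\<alpha> \<in> Field \<mu>. i \<in> X \<alpha>}"
    show "|?S| <o \<kappa>"
    proof (rule ccontr)
      assume "\<not> |?S| <o \<kappa>"
      then have "\<kappa> \<le>o |?S|"
        using Card_order_ordLeq_if_not_ordLess[OF card_of_Card_order \<kappa>] by blast
      then have "|Field \<kappa>| \<le>o |?S|"
        using card_of_Field_ordIso[OF \<kappa>] ordIso_ordLeq_trans by blast
      then obtain A where "A \<subseteq> ?S" "|Field \<kappa>| =o |A|"
        using internalize_card_of_ordLeq2[of "Field \<kappa>" ?S] by blast
      then have "|A| =o \<kappa>"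
        using card_of_Field_ordIso[OF \<kappa>] ordIso_symmetric ordIso_transitive by blast
      moreover have "i \<in> (\<Inter>\<alpha>\<in>A. X \<alpha>)"
        using \<open>A \<subseteq> ?S\<close> by blast
      ultimately show False
        using L \<open>A \<subseteq> ?S\<close> by blast
    qed
  next
    fix A
    assume R: "\<forall>i. |{\<alpha> \<in> Field \<mu>. i \<in> X \<alpha>}| <o \<kappa>" and A: "A \<subseteq> Field \<mu> \<and> |A| =o \<kappa>"
    show "(\<Inter>\<alpha>\<in>A. X \<alpha>) = {}"
    proof (rule ccontr)
      assume "(\<Inter>\<alpha>\<in>A. X \<alpha>) \<noteq> {}"
      then obtain i where "A \<subseteq> {\<alpha> \<in> Field \<mu>. i \<in> X \<alpha>}"
        using A by blast
      then have "|A| <o \<kappa>"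
        using R card_of_mono1 ordLeq_ordLess_trans by blast
      then show False
        using A not_ordLess_ordIso by blast
    qed
  qed
  then show ?thesis
    by (simp add: regular_def)
qed

text \<open>Reindexing a witness along an injection of \<open>Field \<mu>'\<close> into
  \<open>Field \<mu>\<close> does not increase the number of indices at any point. With isomorphic
  cardinals, this moves regularity between representations on different types.\<close>

lemma regular_mono:
  assumes reg: "regular \<kappa> \<mu> D" and \<kappa>: "Card_order \<kappa>" and \<kappa>': "Card_order \<kappa>'"
    and le: "\<kappa> \<le>o \<kappa>'" and \<mu>: "\<mu>' \<le>o \<mu>"
  shows "regular \<kappa>' \<mu>' D"
proof -
  obtain X where X: "\<And>\<alpha>. \<alpha> \<in> Field \<mu> \<Longrightarrow> eventually (\<lambda>i. i \<in> X \<alpha>) D"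
    "\<And>i. |{\<alpha> \<in> Field \<mu>. i \<in> X \<alpha>}| <o \<kappa>"
    using reg unfolding regular_iff[OF \<kappa>] by blast
  obtain f where f: "inj_on f (Field \<mu>')" "f ` Field \<mu>' \<subseteq> Field \<mu>"
    using card_of_mono2[OF \<mu>] card_of_ordLeq[of "Field \<mu>'" "Field \<mu>"] by blast
  have "|{\<alpha> \<in> Field \<mu>'. i \<in> X (f \<alpha>)}| <o \<kappa>'" for i
  proof -
    have "inj_on f {\<alpha> \<in> Field \<mu>'. i \<in> X (f \<alpha>)}"
      using f(1) by (rule inj_on_subset) blast
    moreover have "f ` {\<alpha> \<in> Field \<mu>'. i \<in> X (f \<alpha>)} \<subseteq> {\<alpha> \<in> Field \<mu>. i \<in> X \<alpha>}"
      using f(2) by blast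
    ultimately have "|{\<alpha> \<in> Field \<mu>'. i \<in> X (f \<alpha>)}| \<le>o |{\<alpha> \<in> Field \<mu>. i \<in> X \<alpha>}|"
      using card_of_ordLeq by blast
    then show ?thesis
      using X(2) le ordLeq_ordLess_trans ordLess_ordLeq_trans by blast
  qed
  then show ?thesis
    unfolding regular_iff[OF \<kappa>'] using X(1) f(2)
    by (intro exI[of _ "\<lambda>\<alpha>. X (f \<alpha>)"]) blast
qed

text \<open>Condition (b) quantifies \<open>\<nu>'\<close> over relations on the type of
  \<open>\<nu>\<close> only. A smaller cardinal on another type has to be copied there before the
  condition applies to it.\<close>

lemma ex_Cinfinite_ordIso:
  fixes \<kappa> :: "'a rel" and \<nu> :: "'b rel"
  assumes \<kappa>: "Cinfinite \<kappa>" and le: "\<kappa> \<le>o \<nu>"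
  shows "\<exists>\<kappa>' :: 'b rel. Cinfinite \<kappa>' \<and> \<kappa>' =o \<kappa>"
proof -
  have "|Field \<kappa>| \<le>o |Field \<nu>|"
    using le by (rule card_of_mono2)
  then obtain B :: "'b set" where "|Field \<kappa>| =o |B|"
    using internalize_card_of_ordLeq2[of "Field \<kappa>" "Field \<nu>"] by blast
  moreover have "|Field \<kappa>| =o \<kappa>"
    using \<kappa> card_of_Field_ordIso by blast
  ultimately have iso: "|B| =o \<kappa>"
    using ordIso_symmetric ordIso_transitive by blast
  have "Cinfinite |B|"
    using Cinfinite_cong[OF ordIso_symmetric[OF iso] \<kappa>] .
  then show ?thesis
    using iso by blast
qed

text \<open>A point \<open>(i, j)\<close> lies in exactly as many cylinders
  \<open>X \<alpha> \<times> UNIV\<close> as \<open>i\<close> lies in sets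
  \<open>X \<alpha>\<close>.\<close>

lemma regular_ultrafilter_prod_left:
  assumes "Card_order \<kappa>" and "regular \<kappa> \<mu> D"
  shows "regular \<kappa> \<mu> (D \<times>\<^sub>U D')"
proof -
  obtain X where X: "\<And>\<alpha>. \<alpha> \<in> Field \<mu> \<Longrightarrow> eventually (\<lambda>i. i \<in> X \<alpha>) D"
    "\<And>i. |{\<alpha> \<in> Field \<mu>. i \<in> X \<alpha>}| <o \<kappa>"
    using assms(2) unfolding regular_iff[OF assms(1)] by blast
  have "eventually (\<lambda>p. p \<in> X \<alpha> \<times> UNIV) (D \<times>\<^sub>U D')" if "\<alpha> \<in> Field \<mu>" for \<alpha>
    unfolding eventually_ultrafilter_prod by (rule eventually_mono[OF X(1)[OF that]]) simp
  then show ?thesis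
    unfolding regular_iff[OF assms(1)] using X(2)
    by (intro exI[of _ "\<lambda>\<alpha>. X \<alpha> \<times> UNIV"]) auto
qed

lemma regular_ultrafilter_prod_right:
  assumes "Card_order \<kappa>" and "regular \<kappa> \<mu> D'"
  shows "regular \<kappa> \<mu> (D \<times>\<^sub>U D')"
proof -
  obtain X where "\<And>\<alpha>. \<alpha> \<in> Field \<mu> \<Longrightarrow> eventually (\<lambda>i. i \<in> X \<alpha>) D'"
    "\<And>i. |{\<alpha> \<in> Field \<mu>. i \<in> X \<alpha>}| <o \<kappa>"
    using assms(2) unfolding regular_iff[OF assms(1)] by blast
  then show ?thesis
    unfolding regular_iff[OF assms(1)]
    by (intro exI[of _ "\<lambda>\<alpha>. UNIV \<times> X \<alpha>"]) (auto simp: eventually_ultrafilter_prod)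
qed

lemma regular_ultrafilter_prodI:
  fixes D :: "'i filter" and D' :: "'j filter"
    and \<kappa> :: "'l rel" and \<mu> :: "'m rel" and \<nu> :: "'n rel"
  assumes \<kappa>: "Cinfinite \<kappa>" and \<nu>: "Cinfinite \<nu>" and D: "regular \<nu> \<mu> D"
    and D': "\<And>\<nu>' :: 'n rel. Cinfinite \<nu>' \<Longrightarrow> \<nu>' <o \<nu> \<Longrightarrow> regular \<kappa> \<nu>' D'"
  shows "regular \<kappa> \<mu> (D \<times>\<^sub>U D')"
proof -
  have co: "Card_order \<kappa>" "Card_order \<nu>"
    using \<kappa> \<nu> by blast+
  obtain Y where Y: "\<And>\<alpha>. \<alpha> \<in> Field \<mu> \<Longrightarrow> eventually (\<lambda>i. i \<in> Y \<alpha>) D"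
    "\<And>i. |{\<alpha> \<in> Field \<mu>. i \<in> Y \<alpha>}| <o \<nu>"
    using D unfolding regular_iff[OF co(2)] by blast
  define S where "S i = {\<alpha> \<in> Field \<mu>. i \<in> Y \<alpha>}" for i
  have "\<exists>X. (\<forall>\<alpha>\<in>S i. eventually (\<lambda>j. j \<in> X \<alpha>) D') \<and> (\<forall>j. |{\<alpha> \<in> S i. j \<in> X \<alpha>}| <o \<kappa>)" for i
  \<comment> \<open>The assumption on \<open>D'\<close> covers infinite cardinals only. For finite
    \<open>S i\<close> a constant family works, since fewer than \<open>\<kappa>\<close> indices
    occur at all.\<close>
  proof (cases "finite (S i)")
    case True
    then have "|S i| <o \<kappa>"
      using \<kappa> by (metis Cfinite_ordLess_Cinfinite card_of_Card_order cfinite_def Field_card_of)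
    then show ?thesis
      by (intro exI[of _ "\<lambda>_. UNIV"]) simp
  next
    case False
    then have inf: "Cinfinite |S i|"
      by (simp add: cinfinite_def Field_card_of card_of_card_order_on)
    have less: "|S i| <o \<nu>"
      using Y(2) by (simp add: S_def)
    obtain \<nu>' :: "'n rel" where \<nu>': "Cinfinite \<nu>'" "\<nu>' =o |S i|"
      using ex_Cinfinite_ordIso[OF inf ordLess_imp_ordLeq[OF less]] by blast
    have "regular \<kappa> \<nu>' D'"
      using D'[OF \<nu>'(1) ordIso_ordLess_trans[OF \<nu>'(2) less]] .
    then have "regular \<kappa> |S i| D'"
      using regular_mono co(1) ordLeq_refl \<nu>'(2) ordIso_symmetric ordIso_imp_ordLeq by blast
    then show ?thesis
      unfolding regular_iff[OF co(1)] by (simp add: Field_card_of)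
  qed
  then obtain X where X: "\<And>i \<alpha>. \<alpha> \<in> S i \<Longrightarrow> eventually (\<lambda>j. j \<in> X i \<alpha>) D'"
    "\<And>i j. |{\<alpha> \<in> S i. j \<in> X i \<alpha>}| <o \<kappa>"
    by metis
  \<comment> \<open>For \<open>i \<in> Y \<alpha>\<close>, the section of \<open>Z \<alpha>\<close>
    at \<open>i\<close> is \<open>X i \<alpha>\<close>, which is large because
    \<open>\<alpha> \<in> S i\<close>.\<close>
  define Z where "Z \<alpha> = {(i, j). i \<in> Y \<alpha> \<and> j \<in> X i \<alpha>}" for \<alpha>
  have "eventually (\<lambda>p. p \<in> Z \<alpha>) (D \<times>\<^sub>U D')" if "\<alpha> \<in> Field \<mu>" for \<alpha>
    unfolding eventually_ultrafilter_prod
    using Y(1)[OF that] by (rule eventually_mono) (use X(1) that in \<open>simp add: S_def Z_def\<close>)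
  moreover have "{\<alpha> \<in> Field \<mu>. (i, j) \<in> Z \<alpha>} = {\<alpha> \<in> S i. j \<in> X i \<alpha>}" for i j
    by (auto simp: S_def Z_def)
  ultimately show ?thesis
    unfolding regular_iff[OF co(1)] using X(2) by (intro exI[of _ Z]) simp
qed

text \<open>The type \<open>'m set\<close> has room for \<open>\<nu>\<close>: each
  \<open>S i\<close> is a set of elements of \<open>'m\<close>, so by Cantor's theorem the
  cardinality of \<open>'m set\<close> is a strict upper bound.\<close>

lemma regular_ultrafilter_prodD:
  fixes D :: "'i filter" and D' :: "'j filter" and \<kappa> :: "'l rel" and \<mu> :: "'m rel"
  assumes \<kappa>: "Cinfinite \<kappa>" and \<mu>: "Cinfinite \<mu>" and reg: "regular \<kappa> \<mu> (D \<times>\<^sub>U D')"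
  shows "\<exists>\<nu> :: 'm set rel. Cinfinite \<nu> \<and> regular \<nu> \<mu> D \<and>
    (\<forall>\<nu>' :: 'm set rel. Cinfinite \<nu>' \<and> \<nu>' <o \<nu> \<longrightarrow> regular \<kappa> \<nu>' D')"
proof -
  have co: "Card_order \<kappa>"
    using \<kappa> by blast
  obtain Z where Z: "\<And>\<alpha>. \<alpha> \<in> Field \<mu> \<Longrightarrow> eventually (\<lambda>p. p \<in> Z \<alpha>) (D \<times>\<^sub>U D')"
    "\<And>p. |{\<alpha> \<in> Field \<mu>. p \<in> Z \<alpha>}| <o \<kappa>"
    using reg unfolding regular_iff[OF co] by blast
  define Y where "Y \<alpha> = {i. eventually (\<lambda>j. (i, j) \<in> Z \<alpha>) D'}" for \<alpha>
  define S where "S i = {\<alpha> \<in> Field \<mu>. i \<in> Y \<alpha>}" for i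
  \<comment> \<open>The members of \<open>R\<close> are the infinite cardinals on
    \<open>'m set\<close> for which \<open>Y\<close> is a witness on \<open>D\<close>.\<close>
  define R :: "'m set rel set" where "R = {\<nu>. Cinfinite \<nu> \<and> (\<forall>i. |S i| <o \<nu>)}"
  have "infinite (UNIV :: 'm set)"
    using \<mu> finite_subset[OF subset_UNIV] by (auto simp: cinfinite_def)
  then have "Cinfinite |UNIV :: 'm set set|"
    by (simp add: cinfinite_def Field_card_of card_of_card_order_on Finite_Set.finite_set)
  moreover have "|S i| <o |UNIV :: 'm set set|" for i
    using ordLeq_ordLess_trans[OF card_of_mono1[OF subset_UNIV] card_of_Pow[of "UNIV :: 'm set"]]
    by simp
  ultimately have "|UNIV :: 'm set set| \<in> R"
    by (simp add: R_def)
  then obtain \<nu> where \<nu>: "\<nu> \<in> R" and least: "\<And>\<nu>'. \<nu>' <o \<nu> \<Longrightarrow> \<nu>' \<notin> R"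
    by (rule wfE_min[OF wf_ordLess]) blast
  have \<nu>_co: "Cinfinite \<nu>" "Card_order \<nu>"
    using \<nu> by (simp_all add: R_def)
  have "regular \<nu> \<mu> D"
    unfolding regular_iff[OF \<nu>_co(2)]
    using Z(1) \<nu> by (intro exI[of _ Y]) (simp add: R_def S_def Y_def eventually_ultrafilter_prod)
  moreover have "regular \<kappa> \<nu>' D'" if \<nu>': "Cinfinite \<nu>'" "\<nu>' <o \<nu>" for \<nu>' :: "'m set rel"
  proof -
    \<comment> \<open>By minimality \<open>\<nu>'\<close> is not in \<open>R\<close>. Being an
      infinite cardinal, it can only fail the bound at some \<open>i\<close>.\<close>
    obtain i where i: "\<not> |S i| <o \<nu>'"
      using least[OF \<nu>'(2)] \<nu>'(1) by (auto simp: R_def)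
    then have le: "\<nu>' \<le>o |S i|"
      using Card_order_ordLeq_if_not_ordLess[OF card_of_Card_order _ i] \<nu>'(1) by blast
    have "|{\<alpha> \<in> S i. (i, j) \<in> Z \<alpha>}| <o \<kappa>" for j
      by (rule ordLeq_ordLess_trans[OF card_of_mono1 Z(2)[of "(i, j)"]]) (auto simp: S_def)
    then have "regular \<kappa> |S i| D'"
      unfolding regular_iff[OF co]
      by (intro exI[of _ "\<lambda>\<alpha>. {j. (i, j) \<in> Z \<alpha>}"]) (simp add: Field_card_of S_def Y_def)
    then show ?thesis
      using regular_mono[OF _ co co] ordLeq_refl[OF co] le by blast
  qed
  ultimately show ?thesis
    using \<nu>_co(1) by blast
qed

(* \<kappa> and \<mu> are the two infinite cardinals of the statement.
   In the first conjunct the cardinal \<nu> ranges over Card_orders on 'm set, which represent all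
   cardinals up to 2^|'m|, in particular up to the successor of \<mu>. The second conjunct says that
   a \<nu> of any size, on an arbitrary type 'n, also yields (a). *)
theorem proposition7p1:
  fixes D :: "'i filter" and D' :: "'j filter"
    and \<kappa> :: "'l rel" and \<mu> :: "'m rel"
  assumes "ultrafilter D" and "ultrafilter D'"
    and "Cinfinite \<kappa>" and "Cinfinite \<mu>"
  shows
    "(regular \<kappa> \<mu> (D \<times>\<^sub>U D') \<longleftrightarrow>
       (\<exists>\<nu> :: 'm set rel. Cinfinite \<nu> \<and> regular \<nu> \<mu> D \<and>
          (\<forall>\<nu>' :: 'm set rel. Cinfinite \<nu>' \<and> \<nu>' <o \<nu> \<longrightarrow> regular \<kappa> \<nu>' D')))
     \<and>
     ((\<exists>\<nu> :: 'n rel. Cinfinite \<nu> \<and> regular \<nu> \<mu> D \<and>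
          (\<forall>\<nu>' :: 'n rel. Cinfinite \<nu>' \<and> \<nu>' <o \<nu> \<longrightarrow> regular \<kappa> \<nu>' D'))
        \<longrightarrow> regular \<kappa> \<mu> (D \<times>\<^sub>U D'))
     \<and>
     (regular \<kappa> \<kappa> (D \<times>\<^sub>U D') \<longleftrightarrow> regular \<kappa> \<kappa> D \<or> regular \<kappa> \<kappa> D')"
proof (intro conjI)
  show "regular \<kappa> \<mu> (D \<times>\<^sub>U D') \<longleftrightarrow>
       (\<exists>\<nu> :: 'm set rel. Cinfinite \<nu> \<and> regular \<nu> \<mu> D \<and>
          (\<forall>\<nu>' :: 'm set rel. Cinfinite \<nu>' \<and> \<nu>' <o \<nu> \<longrightarrow> regular \<kappa> \<nu>' D'))"
    using regular_ultrafilter_prodD[OF assms(3,4)] regular_ultrafilter_prodI[OF assms(3)]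
    by blast
  show "(\<exists>\<nu> :: 'n rel. Cinfinite \<nu> \<and> regular \<nu> \<mu> D \<and>
          (\<forall>\<nu>' :: 'n rel. Cinfinite \<nu>' \<and> \<nu>' <o \<nu> \<longrightarrow> regular \<kappa> \<nu>' D'))
        \<longrightarrow> regular \<kappa> \<mu> (D \<times>\<^sub>U D')"
    using regular_ultrafilter_prodI[OF assms(3)] by blast
  show "regular \<kappa> \<kappa> (D \<times>\<^sub>U D') \<longleftrightarrow> regular \<kappa> \<kappa> D \<or> regular \<kappa> \<kappa> D'"
  proof
    assume "regular \<kappa> \<kappa> (D \<times>\<^sub>U D')"
    from regular_ultrafilter_prodD[OF assms(3) assms(3) this]
    obtain \<nu> :: "'l set rel" where \<nu>: "Cinfinite \<nu>" "regular \<nu> \<kappa> D"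
      "\<And>\<nu>' :: 'l set rel. Cinfinite \<nu>' \<Longrightarrow> \<nu>' <o \<nu> \<Longrightarrow> regular \<kappa> \<nu>' D'"
      by blast
    show "regular \<kappa> \<kappa> D \<or> regular \<kappa> \<kappa> D'"
    \<comment> \<open>If \<open>\<nu> \<le>o \<kappa>\<close>, the regularity of \<open>D\<close>
      weakens to the desired one. Otherwise \<open>\<kappa>\<close> is itself, up to a copy on
      \<open>'l set\<close>, an admissible \<open>\<nu>'\<close>, and \<open>D'\<close> is
      regular.\<close>
    proof (cases "\<kappa> <o \<nu>")
      case False
      then have "\<nu> \<le>o \<kappa>"
        using Card_order_ordLeq_if_not_ordLess[of \<kappa> \<nu>] \<nu>(1) assms(3) by blast
      then show ?thesis
        using regular_mono[OF \<nu>(2), of \<kappa> \<kappa>] \<nu>(1) assms(3) ordLeq_refl[of \<kappa>] by simp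
    next
      case less: True
      obtain \<nu>' :: "'l set rel" where \<nu>': "Cinfinite \<nu>'" "\<nu>' =o \<kappa>"
        using ex_Cinfinite_ordIso[OF assms(3) ordLess_imp_ordLeq[OF less]] by blast
      have "regular \<kappa> \<nu>' D'"
        using \<nu>(3)[OF \<nu>'(1) ordIso_ordLess_trans[OF \<nu>'(2) less]] .
      then show ?thesis
        using regular_mono[of \<kappa> \<nu>' D' \<kappa> \<kappa>] assms(3) \<nu>'
        by (meson ordIso_symmetric ordIso_imp_ordLeq ordLeq_refl)
    qed
  next
    assume "regular \<kappa> \<kappa> D \<or> regular \<kappa> \<kappa> D'"
    then show "regular \<kappa> \<kappa> (D \<times>\<^sub>U D')"
      using regular_ultrafilter_prod_left regular_ultrafilter_prod_right assms(3) by blast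
  qed
qed

end
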